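(* For the battery charging game with any number $T$ of time steps, the price of stability for uniform price profiles, and therefore also the price of stability for the class of all price profiles, equals $1$: $\mathrm{PoS}_{\mathrm{ANY}}=\mathrm{PoS}_{\mathrm{UNI}}=1$.
   Context: **Battery charging game.** An instance consists of: a number of time steps $T\in\mathbb{N}$, with $[T]=\{1,\dots,T\}$; a finite directed graph $H=(V,E)$; for each $t\in[T]$ a copy $H_t=(V_t,E_t)$ of $H$ (the copy of $v\in V$ is $v_t$); a capacity $\kappa(e_t)\ge 0$ for each $e_t\in E_t$; a value $d(v_t)\in\mathbb{R}$ for each $v_t\in V_t$ (positive: supply, negative: demand); a finite set $B$ of battery agents, each $b\in B$ having a location $v^b\in V$, battery nodes $b_1,\dots,b_T$, and battery edges $(b_t,b_{t+1})$, $t\in[T-1]$, with capacities $\kappa((b_t,b_{t+1}))\ge 0$. For each $b,t$ there are two transaction edges $(b_t,v^b_t)$ and $(v^b_t,b_t)$ (with infinite capacity under $\kappa$). The graph $G$ is the union of all $H_t$, all battery nodes, battery edges and transaction edges. In addition there is a source $x$ with edges $(x,v_t)$ of capacity $\max(0,d(v_t))$ and a target $y$ with edges $(v_t,y)$ of capacity $\max(0,-d(v_t))$, for all $v_t\in V_t$, $t\in[T]$. **Strategies.** A strategy of agent $b$ is a vector $s_b=(s_{b,t})_{t\in[T]}\in\mathbb{R}^{[T]}$ (positive entries: charging, negative: discharging) with $0\le\sum_{z=1}^t s_{b,z}\le\kappa((b_t,b_{t+1}))$ for each $t\in[T-1]$. A strategy profile $\mathbf{s}$ consists of one strategy per agent.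 **Flow.** Given $\mathbf{s}$, $\kappa_{\mathbf{s}}$ is defined by $\kappa_{\mathbf{s}}((v^b_t,b_t))=\max(0,s_{b,t})$, $\kappa_{\mathbf{s}}((b_t,v^b_t))=\max(0,-s_{b,t})$, and $\kappa_{\mathbf{s}}=\kappa$ on all other edges; $G_{\mathbf{s}}$ is the graph $G$ (with $x,y$) with capacities $\kappa_{\mathbf{s}}$. Flows are (real-valued) feasible $x$-$y$-flows, the value $|f|$ being the flow out of $x$; a maximum flow is one of maximum value. **Admissibility.** A transaction edge $e$ is admissible for $\mathbf{s}$ if every maximum flow $f$ in $G_{\mathbf{s}}$ saturates it, i.e. $f(e)=\kappa_{\mathbf{s}}(e)$. A strategy $s_b$ is admissible for $\mathbf{s}$ if all transaction edges of agent $b$ are admissible; $\mathbf{s}$ is admissible if all its strategies are. **Utilities.** For a price profile $\mathbf{p}=(p_t)_{t\in[T]}\in\mathbb{R}^{[T]}$, $u_b(\mathbf{s},\mathbf{p})=-\infty$ if $s_b$ is not admissible for $\mathbf{s}$, and $u_b(\mathbf{s},\mathbf{p})=-\sum_{t\in[T]}s_{b,t}p_t$ otherwise. **Nash equilibrium.** $\mathbf{s}$ is a (pure) Nash equilibrium for $\mathbf{p}$ if there is no agent $b$ with a strategy $s'_b$ such that $u_b((s'_b,\mathbf{s}_{-b}),\mathbf{p})>u_b(\mathbf{s},\mathbf{p})$. **Welfare and price of stability.** $W(\mathbf{s})$ is the value of a maximum flow in $G_{\mathbf{s}}$; $\mathrm{OPT}(G)$ is a strategy profile of maximum welfare (over all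 strategy profiles); $\mathrm{bestNE}(G,\mathbf{p})$ is a Nash equilibrium for $\mathbf{p}$ of maximum welfare (the ratio below is read as the infimum of the ratios over all Nash equilibria). For a class $P$ of price profiles (prices may depend on $G$), $$\mathrm{PoS}_P=\sup_G\ \inf_{\mathbf{p}\in P}\frac{W(\mathrm{OPT}(G))}{W(\mathrm{bestNE}(G,\mathbf{p}))},$$ with $G$ ranging over all instances with the given number $T$ of time steps. Conventions: $0/0=1$, $a/0=\infty$ for $a>0$; the infimum is over those $\mathbf{p}\in P$ admitting a Nash equilibrium and the supremum over those $G$ for which such $\mathbf{p}$ exists. **Price classes.** UNI: $p_1=p_2=\dots=p_T$. ANY: all price profiles in $\mathbb{R}^{[T]}$. *)

theory Defs
  imports "HOL-Analysis.Analysis" "Graph_Theory.Pair_Digraph"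
begin

section \<open>Instances\<close>

text \<open>
  The digraph \<open>H\<close> has no parallel edges. The data of an instance are total functions; only
  the arguments mentioned in \<open>battery_game\<close> below carry meaning: \<open>grid_cap G t (u, w)\<close> is the
  capacity of the copy of \<open>(u, w)\<close> at time \<open>t\<close>, \<open>net_supply G t v\<close> is \<open>d(v\<^sub>t)\<close>, and
  \<open>bat_cap G b t\<close> is the capacity of the battery edge \<open>(b\<^sub>t, b\<^sub>t\<^sub>+\<^sub>1)\<close>.
\<close>

record ('v, 'b) battery_game =
  steps :: nat
  grid :: "'v pair_pre_digraph"
  grid_cap :: "nat \<Rightarrow> 'v \<times> 'v \<Rightarrow> real"
  net_supply :: "nat \<Rightarrow> 'v \<Rightarrow> real"
  agents :: "'b set"
  location :: "'b \<Rightarrow> 'v"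
  bat_cap :: "'b \<Rightarrow> nat \<Rightarrow> real"

definition battery_game :: "('v, 'b) battery_game \<Rightarrow> bool" where
  "battery_game G \<longleftrightarrow>
     pair_fin_digraph (grid G) \<and>
     (\<forall>t\<in>{1..steps G}. \<forall>e\<in>parcs (grid G). 0 \<le> grid_cap G t e) \<and>
     finite (agents G) \<and>
     (\<forall>b\<in>agents G. location G b \<in> pverts (grid G)) \<and>
     (\<forall>b\<in>agents G. \<forall>t\<in>{1..steps G - 1}. 0 \<le> bat_cap G b t)"

definition games :: "nat \<Rightarrow> ('v, 'b) battery_game set" where
  "games T = {G. battery_game G \<and> steps G = T}"

section \<open>The network\<close>

datatype ('v, 'b) node = Grid 'v nat | Battery 'b nat | Source | Target

definition grid_edges :: "('v, 'b) battery_game \<Rightarrow> (('v, 'b) node) rel" where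
  "grid_edges G =
     {(Grid u t, Grid w t) |u w t. t \<in> {1..steps G} \<and> (u, w) \<in> parcs (grid G)}"

definition battery_edges :: "('v, 'b) battery_game \<Rightarrow> (('v, 'b) node) rel" where
  "battery_edges G =
     {(Battery b t, Battery b (t + 1)) |b t. b \<in> agents G \<and> t \<in> {1..steps G - 1}}"

definition transaction_edges :: "('v, 'b) battery_game \<Rightarrow> 'b \<Rightarrow> (('v, 'b) node) rel" where
  "transaction_edges G b =
     {(Battery b t, Grid (location G b) t) |t. t \<in> {1..steps G}} \<union>
     {(Grid (location G b) t, Battery b t) |t. t \<in> {1..steps G}}"

definition terminal_edges :: "('v, 'b) battery_game \<Rightarrow> (('v, 'b) node) rel" where
  "terminal_edges G =
     {(Source, Grid v t) |v t. v \<in> pverts (grid G) \<and> t \<in> {1..steps G}} \<union>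
     {(Grid v t, Target) |v t. v \<in> pverts (grid G) \<and> t \<in> {1..steps G}}"

definition network :: "('v, 'b) battery_game \<Rightarrow> (('v, 'b) node) pair_pre_digraph" where
  "network G =
     \<lparr> pverts = {Grid v t |v t. v \<in> pverts (grid G) \<and> t \<in> {1..steps G}} \<union>
               {Battery b t |b t. b \<in> agents G \<and> t \<in> {1..steps G}} \<union> {Source, Target},
       parcs = grid_edges G \<union> battery_edges G \<union> (\<Union>b\<in>agents G. transaction_edges G b) \<union>
               terminal_edges G \<rparr>"

section \<open>Strategies\<close>

text \<open>
  A vector in \<open>\<real>\<^bsup>[T]\<^esup>\<close> is an extensional function on \<open>{1..T}\<close>. The final partial sum
  (\<open>t = T\<close>) is deliberately unconstrained.
\<close>

definition strategies :: "('v, 'b) battery_game \<Rightarrow> 'b \<Rightarrow> (nat \<Rightarrow> real) set" where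
  "strategies G b =
     {s \<in> {1..steps G} \<rightarrow>\<^sub>E UNIV.
        \<forall>t\<in>{1..steps G - 1}. 0 \<le> (\<Sum>z=1..t. s z) \<and> (\<Sum>z=1..t. s z) \<le> bat_cap G b t}"

definition profiles :: "('v, 'b) battery_game \<Rightarrow> ('b \<Rightarrow> nat \<Rightarrow> real) set" where
  "profiles G = (\<Pi>\<^sub>E b\<in>agents G. strategies G b)"

section \<open>Flows\<close>

text \<open>
  This is \<open>\<kappa>\<^sub>s\<close>. The infinite capacity of transaction edges under \<open>\<kappa>\<close> is always overridden
  by the strategies, so all capacities are real numbers. The last equation concerns pairs that
  are not edges of the network.
\<close>

fun capacity ::
  "('v, 'b) battery_game \<Rightarrow> ('b \<Rightarrow> nat \<Rightarrow> real) \<Rightarrow> ('v, 'b) node \<times> ('v, 'b) node \<Rightarrow> real" where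
  "capacity G s (Grid u t, Grid w t') = grid_cap G t (u, w)"
| "capacity G s (Battery b t, Battery b' t') = bat_cap G b t"
| "capacity G s (Grid v t', Battery b t) = max 0 (s b t)"
| "capacity G s (Battery b t, Grid v t') = max 0 (- s b t)"
| "capacity G s (Source, Grid v t) = max 0 (net_supply G t v)"
| "capacity G s (Grid v t, Target) = max 0 (- net_supply G t v)"
| "capacity G s _ = 0"

definition feasible_flow ::
  "('v, 'b) battery_game \<Rightarrow> ('b \<Rightarrow> nat \<Rightarrow> real) \<Rightarrow> (('v, 'b) node \<times> ('v, 'b) node \<Rightarrow> real) \<Rightarrow> bool"
where
  "feasible_flow G s f \<longleftrightarrow>
     (\<forall>e\<in>parcs (network G). 0 \<le> f e \<and> f e \<le> capacity G s e) \<and>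
     (\<forall>n\<in>pverts (network G) - {Source, Target}.
        (\<Sum>e\<in>in_arcs (network G) n. f e) = (\<Sum>e\<in>out_arcs (network G) n. f e))"

definition flow_value ::
  "('v, 'b) battery_game \<Rightarrow> (('v, 'b) node \<times> ('v, 'b) node \<Rightarrow> real) \<Rightarrow> real" where
  "flow_value G f = (\<Sum>e\<in>out_arcs (network G) Source. f e)"

definition maximum_flow ::
  "('v, 'b) battery_game \<Rightarrow> ('b \<Rightarrow> nat \<Rightarrow> real) \<Rightarrow> (('v, 'b) node \<times> ('v, 'b) node \<Rightarrow> real) \<Rightarrow> bool"
where
  "maximum_flow G s f \<longleftrightarrow>
     feasible_flow G s f \<and> (\<forall>g. feasible_flow G s g \<longrightarrow> flow_value G g \<le> flow_value G f)"

definition welfare :: "('v, 'b) battery_game \<Rightarrow> ('b \<Rightarrow> nat \<Rightarrow> real) \<Rightarrow> real" where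
  "welfare G s = (THE w. \<exists>f. maximum_flow G s f \<and> flow_value G f = w)"

section \<open>Admissibility, utilities and equilibria\<close>

definition admissible_edge ::
  "('v, 'b) battery_game \<Rightarrow> ('b \<Rightarrow> nat \<Rightarrow> real) \<Rightarrow> ('v, 'b) node \<times> ('v, 'b) node \<Rightarrow> bool" where
  "admissible_edge G s e \<longleftrightarrow> (\<forall>f. maximum_flow G s f \<longrightarrow> f e = capacity G s e)"

definition admissible_strategy ::
  "('v, 'b) battery_game \<Rightarrow> ('b \<Rightarrow> nat \<Rightarrow> real) \<Rightarrow> 'b \<Rightarrow> bool" where
  "admissible_strategy G s b \<longleftrightarrow> (\<forall>e\<in>transaction_edges G b. admissible_edge G s e)"

definition utility ::
  "('v, 'b) battery_game \<Rightarrow> ('b \<Rightarrow> nat \<Rightarrow> real) \<Rightarrow> (nat \<Rightarrow> real) \<Rightarrow> 'b \<Rightarrow> ereal" where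
  "utility G s p b =
     (if admissible_strategy G s b then ereal (- (\<Sum>t=1..steps G. s b t * p t)) else - \<infinity>)"

definition nash_equilibria ::
  "('v, 'b) battery_game \<Rightarrow> (nat \<Rightarrow> real) \<Rightarrow> ('b \<Rightarrow> nat \<Rightarrow> real) set" where
  "nash_equilibria G p =
     {s \<in> profiles G.
        \<not> (\<exists>b\<in>agents G. \<exists>s'\<in>strategies G b. utility G (s(b := s')) p b > utility G s p b)}"

section \<open>Price of stability\<close>

definition OPT :: "('v, 'b) battery_game \<Rightarrow> 'b \<Rightarrow> nat \<Rightarrow> real" where
  "OPT G = arg_max_on (welfare G) (profiles G)"

definition welfare_ratio :: "real \<Rightarrow> real \<Rightarrow> ereal" where
  "welfare_ratio a c = (if c = 0 then (if a = 0 then 1 else \<infinity>) else ereal (a / c))"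

definition price_of_stability ::
  "('v, 'b) battery_game set \<Rightarrow> (nat \<Rightarrow> real) set \<Rightarrow> ereal" where
  "price_of_stability \<G> P =
     (SUP G\<in>{G \<in> \<G>. \<exists>p\<in>P. nash_equilibria G p \<noteq> {}}.
      INF p\<in>{p \<in> P. nash_equilibria G p \<noteq> {}}.
      INF s\<in>nash_equilibria G p. welfare_ratio (welfare G (OPT G)) (welfare G s))"

definition ANY :: "nat \<Rightarrow> (nat \<Rightarrow> real) set" where
  "ANY T = ({1..T} \<rightarrow>\<^sub>E UNIV)"

definition UNI :: "nat \<Rightarrow> (nat \<Rightarrow> real) set" where
  "UNI T = {p \<in> ANY T. \<forall>t\<in>{1..T}. \<forall>t'\<in>{1..T}. p t = p t'}"

end

theory Submission
  imports Defs
begin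

text \<open>
  Let every transaction edge carry arbitrary flow and, among the maximum flows that
  do not charge and discharge a battery in the same step, take one with minimal total flow on the
  transaction edges. The profile that reads the strategies off this flow has optimal welfare, and
  minimality makes it admissible. If a strategy is admissible, a maximum flow realises it exactly,
  so flow conservation forces its entries to sum to zero; under uniform prices its utility is then
  \<open>0\<close>. Hence every admissible profile is an equilibrium for uniform prices.
\<close>

section \<open>Feasible flows\<close>

definition conserves where
  "conserves G f \<longleftrightarrow>
     (\<forall>n\<in>pverts (network G) - {Source, Target}.
        (\<Sum>e\<in>in_arcs (network G) n. f e) = (\<Sum>e\<in>out_arcs (network G) n. f e))"

lemma feasible_flow_iff:
  "feasible_flow G s f \<longleftrightarrow>
     (\<forall>e\<in>parcs (network G). 0 \<le> f e \<and> f e \<le> capacity G s e) \<and> conserves G f"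
  by (simp add: feasible_flow_def conserves_def)

text \<open>Flows are total functions on pairs of nodes, and feasibility says nothing about pairs
  that are not edges. Zeroing these values gives a representative in a compact set.\<close>

definition restrict_flow where
  "restrict_flow G f = (\<lambda>e. if e \<in> parcs (network G) then f e else (0::real))"

lemma sum_restrict_flow:
  assumes "A \<subseteq> parcs (network G)"
  shows "sum (restrict_flow G f) A = sum f A"
  using assms by (intro sum.cong) (auto simp: restrict_flow_def)

lemma conserves_restrict_flow [simp]: "conserves G (restrict_flow G f) \<longleftrightarrow> conserves G f"
proof -
  have "in_arcs (network G) n \<subseteq> parcs (network G)" "out_arcs (network G) n \<subseteq> parcs (network G)" for n
    by (auto simp: in_arcs_def out_arcs_def)
  then show ?thesis
    by (simp add: conserves_def sum_restrict_flow)
qed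

lemma flow_value_restrict_flow [simp]: "flow_value G (restrict_flow G f) = flow_value G f"
  unfolding flow_value_def by (rule sum_restrict_flow) (auto simp: out_arcs_def)

section \<open>Compactness and existence of maximum flows\<close>

lemma continuous_on_coordinate:
  "continuous_on A (\<lambda>f. f e :: 'a::topological_space)"
  by (rule continuous_on_subset[OF continuous_on_product_coordinates]) simp

text \<open>Tychonoff for a product of compact intervals; conservation is closed because it consists
  of equations between continuous functions of \<open>f\<close>.\<close>

lemma compact_flows:
  fixes c :: "('v, 'b) node \<times> ('v, 'b) node \<Rightarrow> real"
  shows "compact {f. (\<forall>e. 0 \<le> f e \<and> f e \<le> c e) \<and> conserves G f}"
proof -
  have "compactin (product_topology (\<lambda>_. euclidean) UNIV) (PiE UNIV (\<lambda>e. {0..c e}))"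
    by (simp add: compactin_PiE)
  then have "compact (PiE UNIV (\<lambda>e. {0..c e}))"
    by (simp add: euclidean_product_topology)
  moreover have "closed {f :: ('v, 'b) node \<times> ('v, 'b) node \<Rightarrow> real. conserves G f}"
    unfolding conserves_def Ball_def
    by (intro closed_Collect_all closed_Collect_imp closed_Collect_eq
        continuous_on_sum continuous_on_coordinate) simp
  ultimately have "compact (PiE UNIV (\<lambda>e. {0..c e}) \<inter> {f. conserves G f})"
    by (rule compact_Int_closed)
  moreover have "PiE UNIV (\<lambda>e. {0..c e}) \<inter> {f. conserves G f} =
      {f. (\<forall>e. 0 \<le> f e \<and> f e \<le> c e) \<and> conserves G f}"
    by auto
  ultimately show ?thesis by simp
qed

lemma continuous_on_flow_value: "continuous_on A (flow_value G)"
  unfolding flow_value_def by (intro continuous_on_sum continuous_on_coordinate)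

lemma finite_parcs_network:
  assumes "battery_game G"
  shows "finite (parcs (network G))"
proof -
  have fin: "finite (parcs (grid G))" "finite (pverts (grid G))" "finite (agents G)"
    using assms unfolding battery_game_def pair_fin_digraph_def pair_fin_digraph_axioms_def by auto
  have "grid_edges G = (\<lambda>((u, w), t). (Grid u t, Grid w t)) ` (parcs (grid G) \<times> {1..steps G})"
    by (force simp: grid_edges_def)
  moreover have "battery_edges G =
      (\<lambda>(b, t). (Battery b t, Battery b (t + 1))) ` (agents G \<times> {1..steps G - 1})"
    by (force simp: battery_edges_def)
  moreover have "terminal_edges G =
      (\<lambda>(v, t). (Source, Grid v t)) ` (pverts (grid G) \<times> {1..steps G}) \<union>
      (\<lambda>(v, t). (Grid v t, Target)) ` (pverts (grid G) \<times> {1..steps G})"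
    by (force simp: terminal_edges_def)
  moreover have "finite (transaction_edges G b)" for b
    by (simp add: transaction_edges_def)
  ultimately show ?thesis
    using fin by (simp add: network_def)
qed

lemma capacity_nonneg:
  assumes "battery_game G" "e \<in> parcs (network G)"
  shows "0 \<le> capacity G s e"
  using assms
  by (auto simp: battery_game_def network_def grid_edges_def battery_edges_def
      transaction_edges_def terminal_edges_def)

lemma flow_value_nonneg: "feasible_flow G s f \<Longrightarrow> 0 \<le> flow_value G f"
  unfolding flow_value_def feasible_flow_def by (intro sum_nonneg) (auto simp: out_arcs_def)

lemma maximum_flow_exists:
  assumes "battery_game G"
  obtains f where "maximum_flow G s f"
proof -
  \<comment> \<open>Capacity \<open>0\<close> off the edges bounds every coordinate, as
    \<open>compact_flows\<close> requires.\<close>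
  define c where "c e = (if e \<in> parcs (network G) then capacity G s e else 0)" for e
  define K where "K = {f. (\<forall>e. 0 \<le> f e \<and> f e \<le> c e) \<and> conserves G f}"
  have "(\<lambda>_. 0) \<in> K"
    using capacity_nonneg[OF assms] by (simp add: K_def c_def conserves_def)
  then have "K \<noteq> {}" by blast
  moreover have "compact K"
    unfolding K_def by (rule compact_flows)
  ultimately obtain f where f: "f \<in> K" "\<And>g. g \<in> K \<Longrightarrow> flow_value G g \<le> flow_value G f"
    using continuous_attains_sup[OF _ _ continuous_on_flow_value, of K G] by blast
  have bounds: "0 \<le> f e" "f e \<le> c e" for e
    using f(1) unfolding K_def by blast+
  have "feasible_flow G s f"
    unfolding feasible_flow_iff
  proof (intro conjI ballI)
    show "f e \<le> capacity G s e" if "e \<in> parcs (network G)" for e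
      using bounds(2)[of e] that by (simp add: c_def)
  qed (use bounds(1) f(1) in \<open>simp_all add: K_def\<close>)
  moreover have "flow_value G g \<le> flow_value G f" if "feasible_flow G s g" for g
  proof -
    \<comment> \<open>The competitor \<open>g\<close> is arbitrary off the edges; its restriction
      has the same value and lies in \<open>K\<close>.\<close>
    have "0 \<le> restrict_flow G g e \<and> restrict_flow G g e \<le> c e" for e
      using that unfolding feasible_flow_iff restrict_flow_def c_def by simp
    then have "restrict_flow G g \<in> K"
      using that unfolding K_def feasible_flow_iff by simp
    then show ?thesis
      using f(2) by fastforce
  qed
  ultimately show thesis
    using that[of f] by (simp add: maximum_flow_def)
qed

lemma welfare_eq_flow_value:
  assumes "maximum_flow G s f"
  shows "welfare G s = flow_value G f"
  unfolding welfare_def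
proof (rule the_equality)
  show "\<exists>g. maximum_flow G s g \<and> flow_value G g = flow_value G f"
    using assms by blast
  show "w = flow_value G f" if "\<exists>g. maximum_flow G s g \<and> flow_value G g = w" for w
    using that assms unfolding maximum_flow_def by (metis order_antisym)
qed

lemma welfare_nonneg:
  assumes "battery_game G"
  shows "0 \<le> welfare G s"
  by (metis maximum_flow_exists[OF assms] welfare_eq_flow_value flow_value_nonneg maximum_flow_def)

section \<open>Charging along a flow\<close>

definition charge where
  "charge G f b t =
     f (Grid (location G b) t, Battery b t) - f (Battery b t, Grid (location G b) t)"

lemma in_arcs_Battery:
  assumes "b \<in> agents G" "t \<in> {1..steps G}"
  shows "in_arcs (network G) (Battery b t) =
    insert (Grid (location G b) t, Battery b t)
      (if t = 1 then {} else {(Battery b (t - 1), Battery b t)})"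
  using assms
  by (auto simp: in_arcs_def network_def grid_edges_def battery_edges_def
      transaction_edges_def terminal_edges_def intro: exI[of _ "t - 1"])

lemma out_arcs_Battery:
  assumes "b \<in> agents G" "t \<in> {1..steps G}"
  shows "out_arcs (network G) (Battery b t) =
    insert (Battery b t, Grid (location G b) t)
      (if t = steps G then {} else {(Battery b t, Battery b (t + 1))})"
  using assms
  by (auto simp: out_arcs_def network_def grid_edges_def battery_edges_def
      transaction_edges_def terminal_edges_def)

text \<open>The energy stored in \<open>b\<close> between steps \<open>t\<close> and
  \<open>t + 1\<close>. The value \<open>0\<close> at \<open>t = 0\<close> and
  \<open>t = steps G\<close> gives the first and last battery nodes the same balance equation as the
  others.\<close>

definition level where
  "level G f b t =
     (if t \<in> {1..steps G - 1} then f (Battery b t, Battery b (t + 1)) else (0::real))"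

lemma charge_eq_level_diff:
  assumes "conserves G f" "b \<in> agents G" "t \<in> {1..steps G}"
  shows "charge G f b t = level G f b t - level G f b (t - 1)"
proof -
  have "Battery b t \<in> pverts (network G) - {Source, Target}"
    using assms by (auto simp: network_def)
  then have "(\<Sum>e\<in>in_arcs (network G) (Battery b t). f e) =
      (\<Sum>e\<in>out_arcs (network G) (Battery b t). f e)"
    using assms(1) unfolding conserves_def by blast
  then show ?thesis
    using assms(3)
    by (auto simp: in_arcs_Battery[OF assms(2,3)] out_arcs_Battery[OF assms(2,3)] charge_def
        level_def split: if_splits)
qed

text \<open>The level differences telescope from \<open>level G f b 0 = 0\<close>.\<close>

lemma sum_charge:
  assumes "conserves G f" "b \<in> agents G"
  shows "t \<le> steps G \<Longrightarrow> (\<Sum>z=1..t. charge G f b z) = level G f b t"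
proof (induction t)
  case 0
  then show ?case by (simp add: level_def)
next
  case (Suc t)
  then show ?case
    using charge_eq_level_diff[OF assms, of "Suc t"] by simp
qed

lemma level_bounds:
  assumes "feasible_flow G s f" "b \<in> agents G" "t \<in> {1..steps G - 1}"
  shows "0 \<le> level G f b t" "level G f b t \<le> bat_cap G b t"
proof -
  have "(Battery b t, Battery b (t + 1)) \<in> parcs (network G)"
    using assms by (auto simp: network_def battery_edges_def)
  then have "0 \<le> f (Battery b t, Battery b (t + 1))"
    "f (Battery b t, Battery b (t + 1)) \<le> capacity G s (Battery b t, Battery b (t + 1))"
    using assms(1) by (auto simp: feasible_flow_iff)
  then show "0 \<le> level G f b t" "level G f b t \<le> bat_cap G b t"
    using assms(3) by (auto simp: level_def)
qed

section \<open>Utilities under uniform prices\<close>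

text \<open>Admissibility makes the net charge of a maximum flow equal to \<open>s b t\<close> at
  every step, and the charges add up to the level after the last step, which is
  \<open>0\<close>.\<close>

lemma sum_admissible_strategy:
  assumes "battery_game G" "b \<in> agents G" "admissible_strategy G s b"
  shows "(\<Sum>t=1..steps G. s b t) = 0"
proof -
  obtain f where f: "maximum_flow G s f"
    using maximum_flow_exists[OF assms(1)] .
  then have "conserves G f"
    by (simp add: maximum_flow_def feasible_flow_iff)
  have "s b t = charge G f b t" if "t \<in> {1..steps G}" for t
  proof -
    have "(Battery b t, Grid (location G b) t) \<in> transaction_edges G b"
      "(Grid (location G b) t, Battery b t) \<in> transaction_edges G b"
      using that by (auto simp: transaction_edges_def)
    \<comment> \<open>Saturation fixes both flows, and
      \<open>max 0 x - max 0 (- x) = x\<close>.\<close>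
    then have "f (Battery b t, Grid (location G b) t) = max 0 (- s b t)"
      "f (Grid (location G b) t, Battery b t) = max 0 (s b t)"
      using f assms(3) by (force simp: admissible_strategy_def admissible_edge_def)+
    then show ?thesis by (simp add: charge_def)
  qed
  then have "(\<Sum>t=1..steps G. s b t) = (\<Sum>t=1..steps G. charge G f b t)"
    by (intro sum.cong) auto
  also have "\<dots> = 0"
    using sum_charge[OF \<open>conserves G f\<close> assms(2), of "steps G"] by (auto simp: level_def)
  finally show ?thesis .
qed

lemma utility_uniform:
  assumes "battery_game G" "b \<in> agents G" "p \<in> UNI (steps G)"
  shows "utility G s p b = (if admissible_strategy G s b then 0 else - \<infinity>)"
proof (cases "admissible_strategy G s b")
  case True
  have "s b t * p t = s b t * p 1" if "t \<in> {1..steps G}" for t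
  proof -
    \<comment> \<open>Step \<open>1\<close> exists because \<open>t\<close> does; for
      \<open>steps G = 0\<close> the sum is empty.\<close>
    have "1 \<in> {1..steps G}"
      using that by simp
    then have "p t = p 1"
      using assms(3) that unfolding UNI_def by blast
    then show ?thesis
      by (rule arg_cong)
  qed
  then have "(\<Sum>t=1..steps G. s b t * p t) = (\<Sum>t=1..steps G. s b t * p 1)"
    by (rule sum.cong[OF refl])
  also have "\<dots> = 0"
    using sum_admissible_strategy[OF assms(1,2) True] by (simp flip: sum_distrib_right)
  finally show ?thesis
    using True by (simp add: utility_def zero_ereal_def)
qed (simp add: utility_def)

text \<open>Before and after any deviation, utilities are \<open>0\<close> or
  \<open>- \<infinity>\<close>, and every agent already has \<open>0\<close>.\<close>

lemma admissible_profile_nash_equilibrium: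
  assumes "battery_game G" "p \<in> UNI (steps G)" "s \<in> profiles G"
    and "\<And>b. b \<in> agents G \<Longrightarrow> admissible_strategy G s b"
  shows "s \<in> nash_equilibria G p"
  using assms by (auto simp: nash_equilibria_def utility_uniform)

section \<open>Flows with unrestricted transactions\<close>

abbreviation all_transaction_edges where
  "all_transaction_edges G \<equiv> \<Union>b\<in>agents G. transaction_edges G b"

lemma all_transaction_edges_subset: "all_transaction_edges G \<subseteq> parcs (network G)"
  by (auto simp: network_def)

lemma all_transaction_edgesE:
  assumes "e \<in> all_transaction_edges G"
  obtains b t where "b \<in> agents G" "t \<in> {1..steps G}"
    "e = (Grid (location G b) t, Battery b t) \<or> e = (Battery b t, Grid (location G b) t)"
  using assms by (auto simp: transaction_edges_def)

text \<open>Strategies affect capacities on transaction edges only, so elsewhere the all-zero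
  strategies can stand in for any others.\<close>

lemma capacity_indep:
  assumes "e \<in> parcs (network G)" "e \<notin> all_transaction_edges G"
  shows "capacity G s e = capacity G s' e"
  using assms by (auto simp: network_def grid_edges_def battery_edges_def terminal_edges_def)

definition transaction_bound where
  "transaction_bound G = (\<Sum>b\<in>agents G. \<Sum>t=1..steps G - 1. bat_cap G b t)"

text \<open>
  Since charging and discharging in the same step is excluded, the battery edges bound the flow on
  transaction edges, so the finite \<open>transaction_bound\<close> can replace the infinite capacity. This
  makes the set compact.
\<close>

definition free_capacity where
  "free_capacity G e =
     (if e \<in> all_transaction_edges G then transaction_bound G
      else if e \<in> parcs (network G) then capacity G (\<lambda>_ _. 0) e else 0)"

text \<open>The product form states that one of two opposite flows vanishes as a continuous
  equation, hence as a closed condition.\<close>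

definition one_sided where
  "one_sided G f \<longleftrightarrow>
     (\<forall>b\<in>agents G. \<forall>t\<in>{1..steps G}.
        f (Grid (location G b) t, Battery b t) * f (Battery b t, Grid (location G b) t) = (0::real))"

definition free_flows where
  "free_flows G = {f. (\<forall>e. 0 \<le> f e \<and> f e \<le> free_capacity G e) \<and> conserves G f} \<inter>
     {f. one_sided G f}"

lemma free_flows_bounds:
  assumes "f \<in> free_flows G"
  shows "0 \<le> f e" "f e \<le> free_capacity G e"
  using assms unfolding free_flows_def by blast+

lemma compact_free_flows:
  fixes G :: "('v, 'b) battery_game"
  shows "compact (free_flows G)"
proof -
  have "closed {f :: ('v, 'b) node \<times> ('v, 'b) node \<Rightarrow> real. one_sided G f}"
    unfolding one_sided_def Ball_def
    by (intro closed_Collect_all closed_Collect_imp closed_Collect_eq continuous_on_mult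
        continuous_on_const continuous_on_coordinate) simp_all
  then show ?thesis
    unfolding free_flows_def by (intro compact_Int_closed compact_flows)
qed

lemma bat_cap_le_transaction_bound:
  assumes "battery_game G" "b \<in> agents G" "t \<in> {1..steps G - 1}"
  shows "bat_cap G b t \<le> transaction_bound G"
proof -
  have fin: "finite (agents G)"
    and nonneg: "\<And>b t. b \<in> agents G \<Longrightarrow> t \<in> {1..steps G - 1} \<Longrightarrow> 0 \<le> bat_cap G b t"
    using assms(1) by (auto simp: battery_game_def)
  have "bat_cap G b t \<le> (\<Sum>t=1..steps G - 1. bat_cap G b t)"
    using nonneg assms by (intro member_le_sum) auto
  also have "\<dots> \<le> transaction_bound G"
    unfolding transaction_bound_def using nonneg fin assms
    by (intro member_le_sum[where f = "\<lambda>b. \<Sum>t=1..steps G - 1. bat_cap G b t"] sum_nonneg) auto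
  finally show ?thesis .
qed

lemma transaction_bound_nonneg:
  assumes "battery_game G"
  shows "0 \<le> transaction_bound G"
  using assms unfolding transaction_bound_def battery_game_def by (intro sum_nonneg) auto

text \<open>Maximising over \<open>free_flows G\<close> thus covers the flows for all
  \<open>s\<close> at once. One of \<open>max 0 x\<close> and \<open>max 0 (- x)\<close> is
  \<open>0\<close>, so \<open>f\<close> is one-sided; the opposite edge then carries the absolute
  difference of two consecutive levels, both between \<open>0\<close> and
  \<open>transaction_bound G\<close>.\<close>

lemma restrict_feasible_flow_in_free_flows:
  assumes "battery_game G" "feasible_flow G s f"
  shows "restrict_flow G f \<in> free_flows G"
proof -
  have cons: "conserves G f"
    and f: "\<And>e. e \<in> parcs (network G) \<Longrightarrow> 0 \<le> f e \<and> f e \<le> capacity G s e"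
    using assms(2) by (auto simp: feasible_flow_iff)
  have level: "0 \<le> level G f b t" "level G f b t \<le> transaction_bound G" if "b \<in> agents G" for b t
  proof -
    have "0 \<le> level G f b t \<and> level G f b t \<le> transaction_bound G"
    proof (cases "t \<in> {1..steps G - 1}")
      case True
      then show ?thesis
        using level_bounds[OF assms(2) that True] bat_cap_le_transaction_bound[OF assms(1) that True]
        by linarith
    next
      case False
      then show ?thesis
        unfolding level_def using transaction_bound_nonneg[OF assms(1)] by auto
    qed
    then show "0 \<le> level G f b t" "level G f b t \<le> transaction_bound G" by auto
  qed
  have mem: "(Grid (location G b) t, Battery b t) \<in> parcs (network G)"
    "(Battery b t, Grid (location G b) t) \<in> parcs (network G)"
    if "b \<in> agents G" "t \<in> {1..steps G}" for b t
    using that by (auto simp: network_def transaction_edges_def)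
  have zero: "f (Grid (location G b) t, Battery b t) = 0 \<or> f (Battery b t, Grid (location G b) t) = 0"
    if "b \<in> agents G" "t \<in> {1..steps G}" for b t
    using f[OF mem(1)[OF that]] f[OF mem(2)[OF that]] by (auto simp: max_def split: if_splits)
  have bound: "f e \<le> transaction_bound G" if "e \<in> all_transaction_edges G" for e
    using that
  proof (rule all_transaction_edgesE)
    fix b t
    assume b: "b \<in> agents G" and t: "t \<in> {1..steps G}"
      and e: "e = (Grid (location G b) t, Battery b t) \<or> e = (Battery b t, Grid (location G b) t)"
    show ?thesis
      using zero[OF b t] charge_eq_level_diff[OF cons b t] level[OF b, of t] level[OF b, of "t - 1"]
        f[OF mem(1)[OF b t]] f[OF mem(2)[OF b t]] e transaction_bound_nonneg[OF assms(1)]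
      unfolding charge_def by (elim disjE) simp_all
  qed
  have "0 \<le> restrict_flow G f e \<and> restrict_flow G f e \<le> free_capacity G e" for e
    using f[of e] bound[of e] all_transaction_edges_subset[of G]
      capacity_indep[of e G s "\<lambda>_ _. 0"]
    unfolding restrict_flow_def free_capacity_def by auto
  moreover have "one_sided G (restrict_flow G f)"
    using zero mem by (auto simp: one_sided_def restrict_flow_def)
  ultimately show ?thesis
    using cons by (simp add: free_flows_def)
qed

section \<open>Profiles read off from flows\<close>

definition induced_profile where
  "induced_profile G f = (\<lambda>b\<in>agents G. \<lambda>t\<in>{1..steps G}. charge G f b t)"

text \<open>By one-sidedness, the positive and negative parts of the net charge are exactly the two
  opposite flows, so \<open>f\<close> saturates the transaction edges of its own profile.\<close>

lemma capacity_induced_profile: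
  assumes "f \<in> free_flows G" "e \<in> all_transaction_edges G"
  shows "capacity G (induced_profile G f) e = f e"
  using assms(2)
proof (rule all_transaction_edgesE)
  fix b t
  assume bt: "b \<in> agents G" "t \<in> {1..steps G}"
    and e: "e = (Grid (location G b) t, Battery b t) \<or> e = (Battery b t, Grid (location G b) t)"
  have "f (Grid (location G b) t, Battery b t) = 0 \<or> f (Battery b t, Grid (location G b) t) = 0"
    using assms(1) bt by (simp add: free_flows_def one_sided_def)
  moreover have "0 \<le> f (Grid (location G b) t, Battery b t)"
    "0 \<le> f (Battery b t, Grid (location G b) t)"
    using free_flows_bounds[OF assms(1)] by blast+
  ultimately show ?thesis
    using e bt by (auto simp: induced_profile_def charge_def)
qed

lemma feasible_induced_profile:
  assumes "f \<in> free_flows G"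
  shows "feasible_flow G (induced_profile G f) f"
proof -
  have "0 \<le> f e \<and> f e \<le> capacity G (induced_profile G f) e" if "e \<in> parcs (network G)" for e
  proof (cases "e \<in> all_transaction_edges G")
    case True
    then show ?thesis
      using capacity_induced_profile[OF assms True] free_flows_bounds[OF assms] by simp
  next
    case False
    then show ?thesis
      using free_flows_bounds[OF assms, of e] that
        capacity_indep[OF that False, of "induced_profile G f" "\<lambda>_ _. 0"]
      unfolding free_capacity_def by simp
  qed
  then show ?thesis
    using assms by (auto simp: feasible_flow_iff free_flows_def)
qed

text \<open>Partial sums of charges are levels, that is, flows on battery edges, which respect the
  battery capacities.\<close>

lemma induced_profile_in_profiles:
  assumes "f \<in> free_flows G"
  shows "induced_profile G f \<in> profiles G"
proof -
  have cons: "conserves G f"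
    using assms by (simp add: free_flows_def)
  have "(\<lambda>t\<in>{1..steps G}. charge G f b t) \<in> strategies G b" if b: "b \<in> agents G" for b
  proof -
    have "0 \<le> (\<Sum>z=1..t. (\<lambda>t\<in>{1..steps G}. charge G f b t) z) \<and>
        (\<Sum>z=1..t. (\<lambda>t\<in>{1..steps G}. charge G f b t) z) \<le> bat_cap G b t"
      if t: "t \<in> {1..steps G - 1}" for t
    proof -
      have "(\<Sum>z=1..t. (\<lambda>t\<in>{1..steps G}. charge G f b t) z) = (\<Sum>z=1..t. charge G f b z)"
        using t by (intro sum.cong) auto
      also have "\<dots> = level G f b t"
        using t by (intro sum_charge[OF cons b]) auto
      finally show ?thesis
        using level_bounds[OF feasible_induced_profile[OF assms] b t] by simp
    qed
    then show ?thesis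
      unfolding strategies_def by (intro CollectI conjI ballI restrict_PiE_iff[THEN iffD2]) simp_all
  qed
  then show ?thesis
    unfolding profiles_def induced_profile_def by auto
qed

section \<open>An optimal admissible profile\<close>

lemma admissible_optimal_profile_exists:
  assumes "battery_game G"
  obtains s where "s \<in> profiles G" "\<And>b. b \<in> agents G \<Longrightarrow> admissible_strategy G s b"
    "\<And>s'. welfare G s' \<le> welfare G s"
proof -
  define volume where "volume f = (\<Sum>e\<in>all_transaction_edges G. f e)" for f :: "_ \<Rightarrow> real"
  have fin: "finite (all_transaction_edges G)"
    using finite_subset[OF all_transaction_edges_subset finite_parcs_network[OF assms]] .
  \<comment> \<open>Any feasible flow shows that \<open>free_flows G\<close> is nonempty; all-zero
    strategies supply one.\<close>
  obtain f0 where "maximum_flow G (\<lambda>_ _. 0) f0"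
    using maximum_flow_exists[OF assms] .
  then have "free_flows G \<noteq> {}"
    using restrict_feasible_flow_in_free_flows[OF assms] unfolding maximum_flow_def by blast
  then obtain f1 where f1: "f1 \<in> free_flows G"
    "\<And>g. g \<in> free_flows G \<Longrightarrow> flow_value G g \<le> flow_value G f1"
    using continuous_attains_sup[OF compact_free_flows _ continuous_on_flow_value] by blast
  \<comment> \<open>The free flows of maximum value form a closed subset of a compact set, so
    \<open>volume\<close> attains its minimum there.\<close>
  define K where "K = free_flows G \<inter> {g. flow_value G g = flow_value G f1}"
  have "compact K"
    unfolding K_def
    by (intro compact_Int_closed compact_free_flows closed_Collect_eq continuous_on_flow_value
        continuous_on_const)
  moreover have "K \<noteq> {}"
    using f1(1) by (auto simp: K_def)
  moreover have "continuous_on K volume"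
    unfolding volume_def by (intro continuous_on_sum continuous_on_coordinate)
  ultimately obtain f where f: "f \<in> K" "\<And>g. g \<in> K \<Longrightarrow> volume f \<le> volume g"
    using continuous_attains_inf[of K volume] by blast
  have free: "f \<in> free_flows G" and val: "flow_value G f = flow_value G f1"
    using f(1) by (auto simp: K_def)
  let ?s = "induced_profile G f"
  \<comment> \<open>This one bound for all \<open>s\<close> gives both that \<open>f\<close> is
    maximum for its own profile and that this profile has optimal welfare.\<close>
  have le: "flow_value G g \<le> flow_value G f" if "feasible_flow G s g" for g s
    using f1(2)[OF restrict_feasible_flow_in_free_flows[OF assms that]] val by simp
  have max: "maximum_flow G ?s f"
    using feasible_induced_profile[OF free] le by (simp add: maximum_flow_def)
  have "g e = capacity G ?s e" if g: "maximum_flow G ?s g" and e: "e \<in> all_transaction_edges G" for g e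
  proof -
    have feas: "feasible_flow G ?s g"
      using g by (simp add: maximum_flow_def)
    have "flow_value G g = flow_value G f"
      using g max by (metis welfare_eq_flow_value)
    then have "restrict_flow G g \<in> K"
      using restrict_feasible_flow_in_free_flows[OF assms feas] val by (simp add: K_def)
    then have "volume f \<le> volume (restrict_flow G g)"
      by (rule f(2))
    also have "\<dots> = volume g"
      unfolding volume_def by (rule sum_restrict_flow[OF all_transaction_edges_subset])
    finally have volume_le: "volume f \<le> volume g" .
    \<comment> \<open>The capacity of \<open>e\<close> under \<open>?s\<close> is \<open>f e\<close>
      itself.\<close>
    have ge: "g e \<le> f e" if "e \<in> all_transaction_edges G" for e
    proof -
      have "e \<in> parcs (network G)"
        using that all_transaction_edges_subset by (rule subsetD[rotated])
      then have "g e \<le> capacity G ?s e"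
        using feas unfolding feasible_flow_iff by blast
      then show ?thesis
        unfolding capacity_induced_profile[OF free that] .
    qed
    have "volume g \<le> volume f"
      unfolding volume_def using ge by (rule sum_mono)
    then have "sum g (all_transaction_edges G) = sum f (all_transaction_edges G)"
      using volume_le unfolding volume_def by (rule order_antisym)
    \<comment> \<open>Termwise inequality with equal finite sums forces termwise equality.\<close>
    then have "g e = f e"
      using ge e fin by (rule sum_mono_inv)
    then show ?thesis
      using capacity_induced_profile[OF free e] by simp
  qed
  then have "admissible_strategy G ?s b" if "b \<in> agents G" for b
    using that unfolding admissible_strategy_def admissible_edge_def by blast
  moreover have "welfare G s' \<le> welfare G ?s" for s'
  proof -
    obtain g where g: "maximum_flow G s' g"
      using maximum_flow_exists[OF assms] .
    then show ?thesis
      using le[of s' g] unfolding welfare_eq_flow_value[OF max] welfare_eq_flow_value[OF g]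
      by (simp add: maximum_flow_def)
  qed
  ultimately show thesis
    by (rule that[OF induced_profile_in_profiles[OF free]])
qed

text \<open>One \<open>s\<close> serves all uniform prices. It shows that the maximum welfare is
  attained, so the profile chosen by \<open>OPT\<close> has the same welfare, though it may differ
  from \<open>s\<close>.\<close>

lemma optimal_uniform_equilibrium_exists:
  assumes "battery_game G"
  obtains s where "\<And>p. p \<in> UNI (steps G) \<Longrightarrow> s \<in> nash_equilibria G p"
    "welfare G s = welfare G (OPT G)" "\<And>s'. welfare G s' \<le> welfare G s"
proof -
  obtain s where s: "s \<in> profiles G" "\<And>b. b \<in> agents G \<Longrightarrow> admissible_strategy G s b"
    "\<And>s'. welfare G s' \<le> welfare G s"
    using admissible_optimal_profile_exists[OF assms] by blast
  have "welfare G (OPT G) = welfare G s"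
    unfolding OPT_def arg_max_on_def
    by (rule arg_max_equality[where f = "welfare G" and P = "\<lambda>x. x \<in> profiles G"]) (simp_all add: s)
  then show thesis
    using that[of s] admissible_profile_nash_equilibrium[OF assms _ s(1,2)] s(3) by simp
qed

section \<open>Evaluating the price of stability\<close>

lemma welfare_ratio_ge_1:
  assumes "0 \<le> c" "c \<le> a"
  shows "1 \<le> welfare_ratio a c"
  using assms by (auto simp: welfare_ratio_def field_simps one_ereal_def)

lemma welfare_ratio_self: "welfare_ratio a a = 1"
  by (simp add: welfare_ratio_def one_ereal_def)

text \<open>A single uniform price in \<open>P\<close> suffices: its optimal equilibrium has ratio
  \<open>1\<close>, and no equilibrium under any price has a smaller ratio. This treats both price
  classes together.\<close>

lemma price_of_stability_eq_1:
  fixes T :: nat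
  assumes "UNI T \<inter> P \<noteq> {}"
  shows "price_of_stability (games T :: ('v, 'b) battery_game set) P = 1"
proof -
  let ?ratio = "\<lambda>G :: ('v, 'b) battery_game. INF p\<in>{p \<in> P. nash_equilibria G p \<noteq> {}}.
    INF s\<in>nash_equilibria G p. welfare_ratio (welfare G (OPT G)) (welfare G s)"
  obtain p where p: "p \<in> UNI T" "p \<in> P"
    using assms by blast
  have equilibria: "p \<in> {p \<in> P. nash_equilibria G p \<noteq> {}}" and inf: "?ratio G = 1"
    if "G \<in> games T" for G :: "('v, 'b) battery_game"
  proof -
    have G: "battery_game G" "steps G = T"
      using that by (auto simp: games_def)
    obtain s where s: "\<And>p. p \<in> UNI T \<Longrightarrow> s \<in> nash_equilibria G p"
      "welfare G s = welfare G (OPT G)" "\<And>s'. welfare G s' \<le> welfare G s"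
      using optimal_uniform_equilibrium_exists[OF G(1)] G(2) by metis
    show eq: "p \<in> {p \<in> P. nash_equilibria G p \<noteq> {}}"
      using p s(1) by blast
    show "?ratio G = 1"
    proof (rule antisym)
      have "?ratio G \<le> welfare_ratio (welfare G (OPT G)) (welfare G s)"
        by (intro INF_lower2[OF eq] INF_lower s(1) p(1))
      then show "?ratio G \<le> 1"
        by (simp add: s(2) welfare_ratio_self)
      show "1 \<le> ?ratio G"
        using s(2,3) by (intro INF_greatest welfare_ratio_ge_1 welfare_nonneg[OF G(1)]) metis
    qed
  qed
  \<comment> \<open>The game on the empty graph keeps the index set of the supremum nonempty; the
    supremum of the empty set would be \<open>- \<infinity>\<close>.\<close>
  let ?G0 = "\<lparr>steps = T, grid = \<lparr>pverts = {}, parcs = {}\<rparr>, grid_cap = \<lambda>_ _. 0,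
    net_supply = \<lambda>_ _. 0, agents = {}, location = undefined, bat_cap = \<lambda>_ _. 0\<rparr>
    :: ('v, 'b) battery_game"
  have "?G0 \<in> games T"
    by (auto simp: games_def battery_game_def intro!: pair_fin_digraph.intro
        pair_wf_digraph.intro pair_fin_digraph_axioms.intro)
  then have "{G \<in> games T :: ('v, 'b) battery_game set. \<exists>p\<in>P. nash_equilibria G p \<noteq> {}} \<noteq> {}"
    using equilibria by blast
  moreover have "?ratio G = 1"
    if "G \<in> {G \<in> games T. \<exists>p\<in>P. nash_equilibria G p \<noteq> {}}" for G :: "('v, 'b) battery_game"
    using that inf by blast
  ultimately show ?thesis
    unfolding price_of_stability_def by (rule SUP_eq_const)
qed

theorem mainTheorem8:
  fixes T :: nat
  shows "price_of_stability (games T :: ('v, 'b) battery_game set) (ANY T) = 1 \<and>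
         price_of_stability (games T :: ('v, 'b) battery_game set) (UNI T) = 1"
proof -
  \<comment> \<open>The zero prices are uniform and belong to both classes.\<close>
  have "(\<lambda>t\<in>{1..T}. 0) \<in> UNI T" "UNI T \<subseteq> ANY T"
    by (auto simp: UNI_def ANY_def)
  then show ?thesis
    by (intro conjI price_of_stability_eq_1) blast+
qed

end
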